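(* The following identity holds: $$\sum_{k=0}^{\infty}\frac{\binom{2k}{k}^2}{32^k}\left\{H_{2k}^{(2)}-\frac{1}{4}H_{k}^{(2)}\right\}=\Gamma\left(\frac{1}{4}\right)^2\frac{\pi^2-8G}{32\pi\sqrt{\pi}}.$$
   Context: For a positive integer $n$, $H_n^{(2)}=\sum_{j=1}^{n}\frac{1}{j^2}$ is the $n$-th harmonic number of order 2, and $H_0^{(2)}=0$ (empty sum). $\Gamma$ is the gamma function, and $G=\sum_{k=0}^{\infty}\frac{(-1)^k}{(1+2k)^2}$ is the Catalan constant. *)

theory Defs
  imports "HOL-Analysis.Analysis"
begin

definition harm2 :: "nat \<Rightarrow> real" where
  "harm2 n = (\<Sum>j=1..n. 1 / real j ^ 2)"

definition catalan_const :: real where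
  "catalan_const = (\<Sum>k. (-1) ^ k / (1 + 2 * real k) ^ 2)"

end

theory Submission
  imports Defs "HOL-Real_Asymp.Real_Asymp"
begin

text \<open>
  For \<open>a + b = 1\<close>, Bailey's theorem evaluates the hypergeometric series \<open>F(a, b; c; 1/2)\<close>. Its
  expansion around \<open>a = b = 1/2\<close> produces, at second order, the weights
  \<open>\<Sum>j<k. 1 / (2j+1)\<^sup>2\<close>, which equal \<open>harm2 (2k) - harm2 k / 4\<close>. Only this expansion
  is needed. Let \<open>A(c)\<close> and \<open>B(c)\<close>
  be the unweighted and the weighted series at \<open>a = b = 1/2\<close>. Creative telescoping gives
  \<open>c (c+1) A(c) = (c + 1/2)\<^sup>2 A(c+2)\<close> and
  \<open>c (c+1) B(c) = (c + 1/2)\<^sup>2 B(c+2) + A(c+2) / 4\<close>, and \<open>A(c) \<longlonglongrightarrow> 1\<close>, \<open>B(c) \<longlonglongrightarrow> 0\<close> for large \<open>c\<close>.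
  Iterating from \<open>c = 1\<close> yields \<open>B(1) / A(1) = \<Sum>i. 1 / (4i+3)\<^sup>2 = (\<pi>\<^sup>2 - 8 G) / 16\<close> and exhibits
  \<open>A(1)\<close> as an infinite product with value \<open>\<Gamma>(1/2) / \<Gamma>(3/4)\<^sup>2\<close>.
\<close>

section \<open>Hypergeometric series at 1/2 and their odd harmonic weights\<close>

definition half_term :: "real \<Rightarrow> nat \<Rightarrow> real" where
  "half_term c k = pochhammer (1/2) k ^ 2 / (fact k * pochhammer c k) / 2 ^ k"

definition odd_harm2 :: "nat \<Rightarrow> real" where
  "odd_harm2 k = (\<Sum>j<k. 1 / (2 * real j + 1) ^ 2)"

text \<open>This is F(1/2, 1/2; c; 1/2), called A(c) above; \<open>half_wsum\<close> below is B(c).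
  Although only \<open>c = 1\<close> is wanted, \<open>c\<close> stays free because the recurrences
  move it by 2.\<close>

definition half_sum :: "real \<Rightarrow> real" where
  "half_sum c = (\<Sum>k. half_term c k)"

definition half_wsum :: "real \<Rightarrow> real" where
  "half_wsum c = (\<Sum>k. half_term c k * odd_harm2 k)"

text \<open>The even indices up to \<open>2 * k\<close> contribute exactly
  \<open>harm2 k / 4\<close>, so only odd reciprocal squares survive.\<close>

lemma harm2_double: "harm2 (2 * k) - 1 / 4 * harm2 k = odd_harm2 k"
proof (induction k)
  case (Suc k)
  have e: "{1..2 * Suc k} = insert (2*k+2) (insert (2*k+1) {1..2*k})" by auto
  have "harm2 (2 * Suc k) = harm2 (2*k) + 1 / (2 * real k + 1)^2 + 1 / (2 * real k + 2)^2"
    unfolding harm2_def e by (simp add: add_ac)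
  moreover have "harm2 (Suc k) = harm2 k + 1 / (real k + 1)^2"
    by (simp add: harm2_def add_ac)
  moreover have "1 / (2 * real k + 2)^2 = 1 / 4 * (1 / (real k + 1)^2)"
    by (simp add: divide_simps) (simp add: power2_eq_square algebra_simps)
  ultimately show ?case
    using Suc.IH by (simp add: odd_harm2_def algebra_simps)
qed (simp add: harm2_def odd_harm2_def)

lemma odd_harm2_nonneg: "odd_harm2 k \<ge> 0"
  by (simp add: odd_harm2_def sum_nonneg)

lemma odd_harm2_le: "odd_harm2 k \<le> real k"
proof -
  have "odd_harm2 k \<le> (\<Sum>j<k. 1)"
    unfolding odd_harm2_def by (intro sum_mono) (simp add: field_simps)
  thus ?thesis by simp
qed

lemma odd_harm2_Suc: "odd_harm2 (Suc k) = odd_harm2 k + 1 / (2 * real k + 1) ^ 2"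
  by (simp add: odd_harm2_def)

text \<open>Duplication of the factorial turns the squared binomial into \<open>16 ^ k\<close> times
  squared Pochhammer quotients; the remaining factor \<open>2 ^ k\<close> of \<open>32 ^ k\<close>
  is the argument 1/2, and for \<open>c = 1\<close> both denominator factors are
  \<open>fact k\<close>.\<close>

lemma central_binomial_half_term:
  "real ((2 * k) choose k) ^ 2 / 32 ^ k = half_term 1 k"
proof -
  have "real ((2 * k) choose k) = fact (2 * k) / (fact k * fact k)"
    by (simp add: binomial_fact)
  also have "\<dots> = 4 ^ k * pochhammer (1/2) k / fact k"
    unfolding fact_double by (simp add: power_mult)
  finally have "real ((2 * k) choose k) ^ 2 = 16 ^ k * pochhammer (1/2) k ^ 2 / fact k ^ 2"
    by (simp add: power_divide power_mult_distrib power2_eq_square flip: power_mult_distrib)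
  moreover have "(32::real) ^ k = 16 ^ k * 2 ^ k"
    by (simp flip: power_mult_distrib)
  ultimately show ?thesis
    by (simp add: half_term_def pochhammer_fact[symmetric] power2_eq_square)
qed

section \<open>Bounds and ratios of the terms\<close>

lemma half_term_pos: "c > 0 \<Longrightarrow> half_term c k > 0"
  by (auto simp: half_term_def intro!: divide_pos_pos mult_pos_pos zero_less_power pochhammer_pos)

lemma pochhammer_mono:
  fixes a b :: real
  assumes "0 \<le> a" "a \<le> b"
  shows "pochhammer a k \<le> pochhammer b k"
  unfolding pochhammer_prod using assms by (intro prod_mono) auto

text \<open>Since 1/2 \<le> 1 \<le> \<open>c\<close>, each numerator Pochhammer is at most
  \<open>fact k\<close>, which is at most \<open>pochhammer c k\<close>; only the geometric factor
  is left.\<close>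

lemma half_term_le:
  assumes "c \<ge> 1"
  shows "half_term c k \<le> (1/2) ^ k"
proof -
  have 1: "pochhammer (1/2::real) k \<le> fact k"
    unfolding pochhammer_fact by (rule pochhammer_mono) auto
  have 2: "fact k \<le> pochhammer c k"
    unfolding pochhammer_fact by (rule pochhammer_mono) (use assms in auto)
  have 0: "pochhammer (1/2::real) k \<ge> 0" by (intro less_imp_le pochhammer_pos) auto
  have "pochhammer (1/2) k ^ 2 \<le> fact k * pochhammer c k"
    unfolding power2_eq_square by (rule mult_mono) (use 0 1 2 in auto)
  moreover have "fact k * pochhammer c k > 0"
    using assms by (intro mult_pos_pos pochhammer_pos) auto
  ultimately have "pochhammer (1/2) k ^ 2 / (fact k * pochhammer c k) \<le> 1"
    by simp
  thus ?thesis
    unfolding half_term_def by (simp add: power_one_over divide_simps)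
qed

lemma half_term_0: "half_term c 0 = 1"
  by (simp add: half_term_def)

lemma half_term_Suc:
  assumes "c > 0"
  shows "half_term c (Suc k) = half_term c k * ((real k + 1/2)^2 / (2 * (real k + 1) * (c + real k)))"
  using assms
  by (simp add: half_term_def pochhammer_Suc power_mult_distrib add_ac mult_ac)

lemma half_term_shift:
  assumes "c > 0"
  shows "half_term (c + 2) k = half_term c k * (c * (c + 1) / ((c + real k) * (c + real k + 1)))"
proof -
  have "pochhammer c (2 + k) = pochhammer c 2 * pochhammer (c + 2) k"
    using pochhammer_product'[of c 2 k] by simp
  moreover have "pochhammer c (2 + k) = pochhammer c k * ((c + real k) * (c + real k + 1))"
    by (simp add: pochhammer_Suc add_ac mult_ac)
  moreover have "pochhammer c 2 = c * (c + 1)"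
    by (simp add: pochhammer_Suc numeral_2_eq_2)
  ultimately have e: "pochhammer (c + 2) k = pochhammer c k * ((c + real k) * (c + real k + 1)) / (c * (c + 1))"
    using assms by (simp add: eq_divide_eq mult_ac)
  show ?thesis unfolding half_term_def e by simp
qed

text \<open>For \<open>k > 0\<close> the first factor \<open>c\<close> can be split off
  \<open>pochhammer c k\<close>, and the other factors are at least those at \<open>c = 1\<close>.
  This gives the decay in \<open>c\<close> behind both limits for large \<open>c\<close>.\<close>

lemma half_term_le_div:
  assumes "c \<ge> 1" "k > 0"
  shows "half_term c k \<le> half_term 1 k / c"
proof -
  obtain m where k: "k = Suc m" using assms(2) by (cases k) auto
  have "c * pochhammer 1 k \<le> pochhammer c k"
    unfolding k pochhammer_rec using assms pochhammer_mono[of 2 "c+1" m] by simp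
  moreover have "pochhammer (1::real) k > 0" by (rule pochhammer_pos) auto
  ultimately have "pochhammer (1/2) k ^ 2 / (fact k * pochhammer c k)
      \<le> pochhammer (1/2) k ^ 2 / (fact k * (c * pochhammer 1 k))"
    using assms by (intro divide_left_mono mult_left_mono) (auto intro!: mult_pos_pos pochhammer_pos)
  hence "half_term c k \<le> pochhammer (1/2) k ^ 2 / (fact k * (c * pochhammer 1 k)) / 2 ^ k"
    unfolding half_term_def by (intro divide_right_mono) auto
  thus ?thesis by (simp add: half_term_def mult_ac)
qed

section \<open>Convergence of both series\<close>

lemma summable_Suc_half_power: "summable (\<lambda>k. real (Suc k) * (1/2) ^ k)"
  using geometric_deriv_sums[of "1/2::real"] by (auto simp: sums_iff)

lemma half_sum_sums:
  assumes "c \<ge> 1"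
  shows "half_term c sums half_sum c"
proof -
  have "summable (half_term c)"
  proof (rule summable_comparison_test'[of "\<lambda>k. (1/2)^k" 0])
    show "norm (half_term c k) \<le> (1/2)^k" for k
      using half_term_le[OF assms, of k] half_term_pos[of c k] assms by simp
  qed (simp add: summable_geometric)
  thus ?thesis by (simp add: half_sum_def summable_sums)
qed

lemma half_wterm_le:
  assumes "c \<ge> 1"
  shows "norm (half_term c k * odd_harm2 k) \<le> real (Suc k) * (1/2) ^ k"
proof -
  have "half_term c k * odd_harm2 k \<le> (1/2)^k * real (Suc k)"
    using half_term_le[OF assms, of k] half_term_pos[of c k] assms odd_harm2_le[of k] odd_harm2_nonneg[of k]
    by (intro mult_mono) auto
  thus ?thesis
    using half_term_pos[of c k] assms odd_harm2_nonneg[of k] by (simp add: mult.commute)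
qed

lemma half_wsum_sums:
  assumes "c \<ge> 1"
  shows "(\<lambda>k. half_term c k * odd_harm2 k) sums half_wsum c"
  unfolding half_wsum_def
  by (intro summable_sums summable_comparison_test'[OF summable_Suc_half_power, of 0] half_wterm_le assms)

section \<open>Recurrences in c by creative telescoping\<close>

lemma telescoping_certificate_LIMSEQ:
  assumes "c \<ge> 1" "f \<longlonglongrightarrow> 0"
  shows "(\<lambda>k. - 2 * (real k / (c + real k)) * f k) \<longlonglongrightarrow> (0::real)"
proof (rule Lim_null_comparison)
  show "\<forall>\<^sub>F k in sequentially. norm (- 2 * (real k / (c + real k)) * f k) \<le> 2 * \<bar>f k\<bar>"
  proof (intro always_eventually allI)
    fix k
    \<comment> \<open>For \<open>c \<ge> 1\<close> the rational factor lies in [0, 1], so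
      multiplying by the certificate preserves decay to 0.\<close>
    have "\<bar>real k / (c + real k)\<bar> \<le> 1" using assms by simp
    hence "\<bar>real k / (c + real k)\<bar> * \<bar>f k\<bar> \<le> 1 * \<bar>f k\<bar>" by (rule mult_right_mono) simp
    moreover have "norm (- 2 * (real k / (c + real k)) * f k) = 2 * (\<bar>real k / (c + real k)\<bar> * \<bar>f k\<bar>)"
      by (simp add: abs_mult)
    ultimately show "norm (- 2 * (real k / (c + real k)) * f k) \<le> 2 * \<bar>f k\<bar>" by linarith
  qed
  show "(\<lambda>k. 2 * \<bar>f k\<bar>) \<longlonglongrightarrow> 0"
    using tendsto_mult_right_zero[OF tendsto_rabs_zero[OF assms(2)]] by simp
qed

lemma half_sum_rec:
  assumes "c \<ge> 1"
  shows "c * (c + 1) * half_sum c = (c + 1/2)^2 * half_sum (c + 2)"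
proof -
  \<comment> \<open>The telescoping certificate is -2k / (c + k). It vanishes at
    \<open>k = 0\<close> and \<open>g\<close> tends to 0, so the differences of \<open>g\<close> sum
    to 0 without boundary terms.\<close>
  define g where "g k = - 2 * (real k / (c + real k)) * half_term c k" for k
  have "g \<longlonglongrightarrow> 0"
    unfolding g_def
    by (intro telescoping_certificate_LIMSEQ assms summable_LIMSEQ_zero sums_summable[OF half_sum_sums])
  from sums_mult[OF telescope_sums[OF this], of "c * (c + 1)"]
  have 1: "(\<lambda>k. c * (c + 1) * (g (Suc k) - g k)) sums 0"
    by (simp add: g_def)
  have 2: "(\<lambda>k. c * (c+1) * half_term c k - (c + 1/2)^2 * half_term (c+2) k) sums
      (c * (c + 1) * half_sum c - (c + 1/2)^2 * half_sum (c + 2))"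
    using assms by (intro sums_diff sums_mult half_sum_sums) auto
  have "c * (c+1) * half_term c k - (c + 1/2)^2 * half_term (c+2) k = c * (c + 1) * (g (Suc k) - g k)" for k
  proof -
    define x where "x = real k"
    have nz: "c + x \<noteq> 0" "c + x + 1 \<noteq> 0" "x + 1 \<noteq> 0" using assms by (auto simp: x_def)
    \<comment> \<open>The termwise recurrence divided by \<open>c * (c + 1) * half_term c k\<close>:
      \<open>half_term_shift\<close> and \<open>half_term_Suc\<close> reduce it to this rational
      identity.\<close>
    have "1 - (c + 1/2)^2 / ((c + x) * (c + x + 1))
      = - 2 * ((x + 1) / (c + x + 1)) * ((x + 1/2)^2 / (2 * (x + 1) * (c + x))) + 2 * (x / (c + x))"
      using nz by (simp add: divide_simps) (simp add: power2_eq_square algebra_simps)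
    hence "c * (c + 1) * half_term c k * (1 - (c + 1/2)^2 / ((c + x) * (c + x + 1)))
      = c * (c + 1) * half_term c k * (- 2 * ((x + 1) / (c + x + 1)) * ((x + 1/2)^2 / (2 * (x + 1) * (c + x))) + 2 * (x / (c + x)))"
      by simp
    moreover have "g (Suc k) - g k = half_term c k * (- 2 * ((x + 1) / (c + x + 1)) *
        ((x + 1/2)^2 / (2 * (x + 1) * (c + x))) + 2 * (x / (c + x)))"
      using assms unfolding g_def by (simp add: half_term_Suc x_def algebra_simps)
    moreover have "half_term (c+2) k = c * (c + 1) * half_term c k / ((c + x) * (c + x + 1))"
      using assms by (simp add: half_term_shift x_def)
    hence "c * (c+1) * half_term c k - (c + 1/2)^2 * half_term (c+2) k
       = c * (c + 1) * half_term c k * (1 - (c + 1/2)^2 / ((c + x) * (c + x + 1)))"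
      by (simp add: right_diff_distrib mult_ac)
    ultimately show ?thesis by (simp add: mult_ac)
  qed
  from sums_unique2[OF 2[unfolded this] 1] show ?thesis by simp
qed

text \<open>The same certificate works with the weight attached. Passing from \<open>k\<close> to
  \<open>k + 1\<close> adds 1 / (2k+1)^2 to the weight, which meets the factor (k + 1/2)^2 of the
  term ratio and leaves 1/4: the source of the inhomogeneous term.\<close>

lemma half_wsum_rec:
  assumes "c \<ge> 1"
  shows "c * (c + 1) * half_wsum c = (c + 1/2)^2 * half_wsum (c + 2) + half_sum (c + 2) / 4"
proof -
  define g where "g k = - 2 * (real k / (c + real k)) * (half_term c k * odd_harm2 k)" for k
  have "g \<longlonglongrightarrow> 0"
    unfolding g_def
    by (intro telescoping_certificate_LIMSEQ assms summable_LIMSEQ_zero sums_summable[OF half_wsum_sums])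
  from sums_mult[OF telescope_sums[OF this], of "c * (c + 1)"]
  have 1: "(\<lambda>k. c * (c + 1) * (g (Suc k) - g k)) sums 0"
    by (simp add: g_def)
  have 2: "(\<lambda>k. c * (c+1) * (half_term c k * odd_harm2 k) - ((c + 1/2)^2 * (half_term (c+2) k * odd_harm2 k)
       + half_term (c+2) k / 4)) sums
      (c * (c + 1) * half_wsum c - ((c + 1/2)^2 * half_wsum (c + 2) + half_sum (c + 2) / 4))"
    using assms by (intro sums_diff sums_add sums_mult sums_divide half_sum_sums half_wsum_sums) auto
  have "c * (c+1) * (half_term c k * odd_harm2 k) - ((c + 1/2)^2 * (half_term (c+2) k * odd_harm2 k)
       + half_term (c+2) k / 4) = c * (c + 1) * (g (Suc k) - g k)" for k
  proof -
    define x where "x = real k"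
    define w where "w = odd_harm2 k"
    have nz: "c + x \<noteq> 0" "c + x + 1 \<noteq> 0" "x + 1 \<noteq> 0" "2 * x + 1 \<noteq> 0" using assms by (auto simp: x_def)
    have "(x + 1/2)^2 * (w + 1 / (2 * x + 1)^2) = (x + 1/2)^2 * w + 1/4"
      using nz(4) by (simp add: divide_simps) (simp add: power2_eq_square algebra_simps)
    hence e: "(x + 1/2)^2 / (2 * (x + 1) * (c + x)) * (w + 1 / (2 * x + 1)^2)
       = ((x + 1/2)^2 * w + 1/4) / (2 * (x + 1) * (c + x))"
      by (simp only: times_divide_eq_left)
    have "w - ((c + 1/2)^2 * w + 1/4) / ((c + x) * (c + x + 1))
      = - 2 * ((x + 1) / (c + x + 1)) * (((x + 1/2)^2 * w + 1/4) / (2 * (x + 1) * (c + x)))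
        + 2 * (x / (c + x)) * w"
    proof -
      \<comment> \<open>Over the common denominator \<open>p * q\<close> only a polynomial identity
        remains, in which the 1/4 inside \<open>M\<close> and \<open>N\<close> cancels.\<close>
      define p q M N where "p = c + x" and "q = c + x + 1"
        and "M = (x + 1/2)^2 * w + 1/4" and "N = (c + 1/2)^2 * w + 1/4"
      have pq: "p \<noteq> 0" "q \<noteq> 0" using nz(1,2) by (auto simp: p_def q_def)
      have "w * (p * q) - N = 2 * x * q * w - M"
        by (simp add: p_def q_def M_def N_def power2_eq_square algebra_simps)
      hence "(w * (p * q) - N) / (p * q) = (2 * x * q * w - M) / (p * q)" by simp
      hence "w - N / (p * q) = 2 * (x / p) * w - M / (p * q)"
        using pq by (simp add: diff_divide_distrib)
      also have "M / (p * q) = 2 * ((x + 1) / q) * (M / (2 * (x + 1) * p))"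
        using nz(3) by (simp add: mult_ac)
      finally show ?thesis unfolding p_def q_def M_def N_def by linarith
    qed
    note identity = this[folded e]
    have g_diff: "g (Suc k) - g k = half_term c k * (- 2 * ((x + 1) / (c + x + 1)) *
         ((x + 1/2)^2 / (2 * (x + 1) * (c + x)) * (w + 1 / (2 * x + 1)^2)) + 2 * (x / (c + x)) * w)"
    proof -
      have "g (Suc k) = half_term c k * (- 2 * ((x + 1) / (c + x + 1)) *
         ((x + 1/2)^2 / (2 * (x + 1) * (c + x)) * (w + 1 / (2 * x + 1)^2)))"
        using assms unfolding g_def by (simp add: half_term_Suc odd_harm2_Suc x_def w_def add_ac mult_ac)
      moreover have "g k = - (half_term c k * (2 * (x / (c + x)) * w))"
        by (simp add: g_def x_def w_def)
      ultimately show ?thesis by (simp only: distrib_left diff_minus_eq_add)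
    qed
    have shift: "half_term (c+2) k = c * (c + 1) * half_term c k / ((c + x) * (c + x + 1))"
      using assms by (simp add: half_term_shift x_def)
    have factor: "K * (T * w) - (L * (K * T / D * w) + K * T / D / 4) = K * T * (w - (L * w + 1/4) / D)"
      for K L T D :: real
      by (simp add: add_divide_distrib algebra_simps)
    show ?thesis
      unfolding shift g_diff w_def[symmetric] factor identity by (simp only: mult.assoc)
  qed
  from sums_unique2[OF 2[unfolded this] 1] show ?thesis by simp
qed

section \<open>Behaviour for large c\<close>

lemma half_sum_bounds:
  assumes "c \<ge> 1"
  shows "1 \<le> half_sum c" "half_sum c \<le> 1 + half_sum 1 / c"
proof -
  have "(\<Sum>k\<in>{0}. half_term c k) \<le> half_sum c"
    unfolding half_sum_def using half_sum_sums[OF assms] half_term_pos[of c] assms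
    by (intro sum_le_suminf) (auto simp: sums_iff less_imp_le)
  thus "1 \<le> half_sum c" by (simp add: half_term_0)
  \<comment> \<open>The term at \<open>k = 0\<close> equals 1 for every \<open>c\<close> and needs
    its own summand, as \<open>half_term_le_div\<close> covers only \<open>k > 0\<close>.\<close>
  have majorant: "(\<lambda>k. (if k = 0 then 1 else 0) + half_term 1 k / c) sums (1 + half_sum 1 / c)"
    by (intro sums_add sums_divide half_sum_sums sums_single[of 0 "\<lambda>_. 1", simplified]) auto
  have "half_term c k \<le> (if k = 0 then 1 else 0) + half_term 1 k / c" for k
    using half_term_le_div[OF assms, of k] assms by (auto simp: half_term_0)
  thus "half_sum c \<le> 1 + half_sum 1 / c"
    by (rule sums_le[OF _ half_sum_sums[OF assms] majorant])
qed

text \<open>The weight vanishes at \<open>k = 0\<close>, so the term that does not decay in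
  \<open>c\<close> is absent here.\<close>

lemma half_wsum_bounds:
  assumes "c \<ge> 1"
  shows "0 \<le> half_wsum c" "half_wsum c \<le> half_wsum 1 / c"
proof -
  show "0 \<le> half_wsum c"
    unfolding half_wsum_def using half_wsum_sums[OF assms] half_term_pos[of c] assms odd_harm2_nonneg
    by (intro suminf_nonneg) (auto simp: sums_iff less_imp_le)
  have "half_term c k * odd_harm2 k \<le> half_term 1 k * odd_harm2 k / c" for k
  proof (cases "k = 0")
    case False
    with half_term_le_div[OF assms, of k] odd_harm2_nonneg[of k]
      mult_right_mono[of "half_term c k" "half_term 1 k / c" "odd_harm2 k"]
    show ?thesis by auto
  qed (simp add: odd_harm2_def)
  thus "half_wsum c \<le> half_wsum 1 / c"
    by (rule sums_le[OF _ half_wsum_sums[OF assms] sums_divide[OF half_wsum_sums]]) auto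
qed

section \<open>Iteration from c = 1\<close>

lemma half_sum_iterate:
  "half_sum 1 * (pochhammer (1/2) n * fact n) = half_sum (1 + 2 * real n) * pochhammer (3/4) n ^ 2"
proof (induction n)
  case (Suc n)
  define x where "x = real n"
  define P where "P = pochhammer (3/4::real) n"
  \<comment> \<open>At \<open>c = 1 + 2 * x\<close> the coefficients are 4 (x + 1/2) (x + 1) and 4
    (x + 3/4)^2, the next factors of the three Pochhammer products.\<close>
  have rec: "(1 + 2 * x) * (2 + 2 * x) * half_sum (1 + 2 * x) = (3/2 + 2 * x)^2 * half_sum (1 + 2 * real (Suc n))"
    using half_sum_rec[of "1 + 2 * x"] by (simp add: x_def algebra_simps)
  have "half_sum 1 * (pochhammer (1/2) (Suc n) * fact (Suc n)) =
    half_sum 1 * (pochhammer (1/2) n * fact n) * ((1 + 2 * x) * (2 + 2 * x) / 4)"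
    by (simp add: pochhammer_Suc x_def algebra_simps)
  also have "\<dots> = (1 + 2 * x) * (2 + 2 * x) * half_sum (1 + 2 * x) * (P^2 / 4)"
    unfolding Suc.IH by (simp add: x_def P_def)
  also have "\<dots> = half_sum (1 + 2 * real (Suc n)) * (P * (3/4 + x)) ^ 2"
    unfolding rec by (simp add: power2_eq_square algebra_simps)
  finally show ?case by (simp add: pochhammer_Suc P_def x_def)
qed simp

text \<open>Dividing the weighted recurrence by the unweighted one shows that the quotient at
  \<open>c\<close> exceeds that at \<open>c + 2\<close> by 1 / (4 (c + 1/2)^2), which is 1 /
  (4n+3)^2 for \<open>c = 1 + 2 * n\<close>.\<close>

lemma half_wsum_iterate:
  "half_wsum 1 / half_sum 1 = half_wsum (1 + 2 * real n) / half_sum (1 + 2 * real n)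
     + (\<Sum>i<n. 1 / (4 * real i + 3) ^ 2)"
proof (induction n)
  case (Suc n)
  define c where "c = 1 + 2 * real n"
  define K where "K = c * (c + 1)"
  define L where "L = (c + 1/2)^2"
  have c: "c \<ge> 1" by (simp add: c_def)
  have pos: "half_sum c > 0" "half_sum (c + 2) > 0"
    using half_sum_bounds(1)[of c] half_sum_bounds(1)[of "c+2"] c by auto
  have KL: "K > 0" "L > 0" using c by (auto simp: K_def L_def intro!: mult_pos_pos)
  have "half_wsum c / half_sum c = (K * half_wsum c) / (K * half_sum c)"
    using KL by simp
  also have "\<dots> = (L * half_wsum (c + 2) + half_sum (c + 2) / 4) / (L * half_sum (c + 2))"
    using half_sum_rec[OF c] half_wsum_rec[OF c] by (simp add: K_def L_def)
  also have "\<dots> = half_wsum (c + 2) / half_sum (c + 2) + 1 / (4 * L)"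
    using pos KL by (simp add: field_simps)
  also have "4 * L = (4 * real n + 3)^2"
    by (simp add: L_def c_def power2_eq_square algebra_simps)
  also have "c + 2 = 1 + 2 * real (Suc n)" by (simp add: c_def)
  finally show ?case using Suc.IH by (simp add: c_def)
qed simp

lemma half_sum_LIMSEQ: "(\<lambda>n. half_sum (1 + 2 * real n)) \<longlonglongrightarrow> 1"
proof (rule tendsto_sandwich[OF _ _ tendsto_const])
  show "(\<lambda>n. 1 + half_sum 1 / (1 + 2 * real n)) \<longlonglongrightarrow> 1"
    by real_asymp
qed (use half_sum_bounds in \<open>auto intro!: always_eventually\<close>)

lemma half_wsum_LIMSEQ: "(\<lambda>n. half_wsum (1 + 2 * real n)) \<longlonglongrightarrow> 0"
proof (rule tendsto_sandwich[OF _ _ tendsto_const])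
  show "(\<lambda>n. half_wsum 1 / (1 + 2 * real n)) \<longlonglongrightarrow> 0"
    by real_asymp
qed (use half_wsum_bounds in \<open>auto intro!: always_eventually\<close>)

lemma sums_half_wsum_ratio:
  "(\<lambda>i. 1 / (4 * real i + 3) ^ 2) sums (half_wsum 1 / half_sum 1)"
proof -
  have "(\<lambda>n. half_wsum 1 / half_sum 1 - half_wsum (1 + 2 * real n) / half_sum (1 + 2 * real n))
     \<longlonglongrightarrow> half_wsum 1 / half_sum 1 - 0 / 1"
    by (intro tendsto_intros half_sum_LIMSEQ half_wsum_LIMSEQ) auto
  moreover have "half_wsum 1 / half_sum 1 - half_wsum (1 + 2 * real n) / half_sum (1 + 2 * real n)
     = (\<Sum>i<n. 1 / (4 * real i + 3) ^ 2)" for n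
    using half_wsum_iterate[of n] by simp
  ultimately show ?thesis by (simp add: sums_def)
qed

section \<open>Gamma value of the unweighted series\<close>

lemma half_sum_1: "half_sum 1 = sqrt pi / Gamma (3/4) ^ 2"
proof -
  let ?G = "Gamma_series :: real \<Rightarrow> nat \<Rightarrow> real"
  \<comment> \<open>The shift to \<open>n + 1\<close> matches the
    \<open>pochhammer z (n + 1)\<close> in \<open>Gamma_series\<close>; by
    \<open>half_sum_iterate\<close> this sequence is constantly \<open>half_sum 1\<close>.\<close>
  have "(\<lambda>n. half_sum (1 + 2 * real (n + 1)) * (?G (1/2) n * ?G 1 n / ?G (3/4) n ^ 2))
     \<longlonglongrightarrow> 1 * (Gamma (1/2) * Gamma 1 / Gamma (3/4) ^ 2)"
    by (intro tendsto_intros LIMSEQ_ignore_initial_segment[OF half_sum_LIMSEQ, of 1])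
       (auto simp: Gamma_eq_zero_iff)
  moreover have "half_sum (1 + 2 * real (n + 1)) * (?G (1/2) n * ?G 1 n / ?G (3/4) n ^ 2) = half_sum 1" for n
  proof -
    have pos: "pochhammer (1/2) (n+1) > (0::real)" "pochhammer (3/4) (n+1) > (0::real)"
      by (auto intro: pochhammer_pos)
    define l where "l = ln (real n)"
    \<comment> \<open>The powers of \<open>n\<close> cancel because 1/2 + 1 = 2 * 3/4.\<close>
    have e: "exp (1/2 * l) * exp (1 * l) = exp (3/4 * l) ^ 2"
      unfolding exp_add[symmetric] exp_double[symmetric] by simp
    have "?G (1/2) n * ?G 1 n / ?G (3/4) n ^ 2 =
      (exp (1/2 * l) * exp (1 * l)) / exp (3/4 * l) ^ 2 *
      (pochhammer (3/4) (n+1) ^ 2 / (pochhammer (1/2) (n+1) * fact (n+1)))"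
      unfolding Gamma_series_def pochhammer_fact[symmetric]
      by (simp add: l_def power_divide power_mult_distrib) (simp add: power2_eq_square mult_ac)
    also have "\<dots> = pochhammer (3/4) (n+1) ^ 2 / (pochhammer (1/2) (n+1) * fact (n+1))"
      unfolding e by simp
    finally have ratio: "?G (1/2) n * ?G 1 n / ?G (3/4) n ^ 2 =
      pochhammer (3/4) (n+1) ^ 2 / (pochhammer (1/2) (n+1) * fact (n+1))" .
    have "pochhammer (1/2) (n+1) * fact (n+1) \<noteq> (0::real)"
      using pos by simp
    thus ?thesis
      unfolding ratio using half_sum_iterate[of "n+1"] by (simp only: times_divide_eq_right divide_eq_eq) simp
  qed
  ultimately have "(\<lambda>n. half_sum 1) \<longlonglongrightarrow> 1 * (Gamma (1/2) * Gamma 1 / Gamma (3/4) ^ 2)"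
    by simp
  thus ?thesis by (simp add: LIMSEQ_const_iff Gamma_one_half_real)
qed

lemma Gamma_quarter: "Gamma (1/4) * Gamma (3/4) = pi * sqrt (2 :: real)"
proof -
  have "complex_of_real (Gamma (1/4) * Gamma (3/4)) = Gamma (of_real (1/4)) * Gamma (1 - of_real (1/4))"
    by (simp only: of_real_mult Gamma_complex_of_real[symmetric]) simp
  also have "\<dots> = of_real pi / sin (of_real pi * of_real (1/4))"
    by (rule Gamma_reflection_complex)
  also have "\<dots> = of_real (pi / sin (pi / 4))"
    by (simp flip: sin_of_real)
  finally have "Gamma (1/4) * Gamma (3/4) = pi / sin (pi / 4)"
    by (simp only: of_real_eq_iff)
  also have "\<dots> = pi * sqrt 2"
    by (simp add: sin_45 real_div_sqrt field_simps)
  finally show ?thesis .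
qed

section \<open>Reciprocal squares of the integers 3 mod 4\<close>

lemma odd_inverse_squares_sums: "(\<lambda>n. 1 / (1 + 2 * real n)^2) sums (pi^2 / 8)"
proof -
  have s: "(\<lambda>n. 1 / (real n + 1)^2) sums (pi^2 / 6)"
    using inverse_squares_sums by (simp add: add_ac)
  \<comment> \<open>Pairing consecutive terms separates odd from even denominators; the even ones
    carry a quarter of pi^2 / 6.\<close>
  have "(\<lambda>n. \<Sum>k\<in>{n*2..<n*2+2}. 1 / (real k + 1)^2) sums (pi^2 / 6)"
    by (rule sums_group[OF s]) simp
  moreover have "(\<Sum>k\<in>{n*2..<n*2+2}. 1 / (real k + 1)^2) = 1 / (1 + 2 * real n)^2 + 1 / (real n + 1)^2 / 4" for n
  proof -
    have "{n*2..<n*2+2} = {2*n, 2*n+1}" by auto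
    moreover have "1 / (2 * real n + 2)^2 = 1 / (real n + 1)^2 / 4"
      by (simp add: divide_simps) (simp add: power2_eq_square algebra_simps)
    ultimately show ?thesis by (simp add: add_ac)
  qed
  ultimately have "(\<lambda>n. 1 / (1 + 2 * real n)^2 + 1 / (real n + 1)^2 / 4) sums (pi^2 / 6)"
    by simp
  from sums_diff[OF this sums_divide[OF s, of 4]] show ?thesis by simp
qed

lemma catalan_const_sums: "(\<lambda>k. (-1) ^ k / (1 + 2 * real k) ^ 2) sums catalan_const"
proof -
  have "summable (\<lambda>k. (-1) ^ k / (1 + 2 * real k) ^ 2)"
    by (rule summable_comparison_test'[OF sums_summable[OF odd_inverse_squares_sums], of 0])
       (simp add: power_abs)
  thus ?thesis unfolding catalan_const_def by (rule summable_sums)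
qed

lemma three_mod_four_inverse_squares_sums:
  "(\<lambda>i. 1 / (4 * real i + 3) ^ 2) sums ((pi^2 - 8 * catalan_const) / 16)"
proof -
  \<comment> \<open>Half the difference of the plain and the alternating series vanishes at even
    \<open>k\<close>; at \<open>k = 2i + 1\<close> the denominator 1 + 2k is 4i + 3.\<close>
  let ?f = "\<lambda>k. (1 / (1 + 2 * real k)^2 - (-1) ^ k / (1 + 2 * real k) ^ 2) / 2"
  have "?f sums ((pi^2 / 8 - catalan_const) / 2)"
    by (intro sums_divide sums_diff odd_inverse_squares_sums catalan_const_sums)
  hence "(\<lambda>n. sum ?f {n*2..<n*2+2}) sums ((pi^2 / 8 - catalan_const) / 2)"
    by (rule sums_group) simp
  moreover have "sum ?f {n*2..<n*2+2} = 1 / (4 * real n + 3)^2" for n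
  proof -
    have "{n*2..<n*2+2} = {2*n, 2*n+1}" by auto
    thus ?thesis by (simp add: add_ac)
  qed
  ultimately show ?thesis by (simp add: field_simps)
qed

theorem theorem1p2:
  shows "(\<lambda>k. real ((2 * k) choose k) ^ 2 / 32 ^ k * (harm2 (2 * k) - 1 / 4 * harm2 k))
    sums (Gamma (1 / 4 :: real) ^ 2 * ((pi ^ 2 - 8 * catalan_const) / (32 * pi * sqrt pi)))"
proof -
  define X where "X = pi ^ 2 - 8 * catalan_const"
  have G: "Gamma (3/4 :: real) > 0" "Gamma (1/4 :: real) > 0" by (auto intro: Gamma_real_pos)
  have "half_sum 1 > 0" using half_sum_bounds(1)[of 1] by simp
  moreover have "half_wsum 1 / half_sum 1 = X / 16"
    using sums_unique2[OF sums_half_wsum_ratio three_mod_four_inverse_squares_sums] by (simp add: X_def)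
  ultimately have "half_wsum 1 = half_sum 1 * (X / 16)" by (simp add: field_simps)
  \<comment> \<open>Expanding by \<open>Gamma (1/4)^2\<close> creates the product evaluated by the
    reflection formula, which removes \<open>Gamma (3/4)\<close>.\<close>
  also have "half_sum 1 = sqrt pi * Gamma (1/4)^2 / (Gamma (1/4) * Gamma (3/4))^2"
    using less_imp_neq[OF G(1)] less_imp_neq[OF G(2)] by (simp add: half_sum_1 power_mult_distrib)
  also have "\<dots> = Gamma (1/4)^2 / (2 * pi * sqrt pi)"
    unfolding Gamma_quarter by (simp add: power_mult_distrib field_simps power2_eq_square)
  finally have "half_wsum 1 = Gamma (1/4)^2 * (X / (32 * pi * sqrt pi))" by simp
  with half_wsum_sums[of 1] show ?thesis
    unfolding central_binomial_half_term harm2_double X_def by simp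
qed

end
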